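(* Let $n\ge 1$. For every $[n]$-decorated binary tree $T$ there exists a unique face $\Phi(T)$ of the Catalan arrangement in $\mathbb{R}^n$ consisting of exactly the points $p=(p_1,\dots,p_n)\in\mathbb{R}^n$ satisfying the following three conditions: (1) for all $i,j\in[n]$, $p_i\le p_j$ if and only if $v_T(i)\preceq_T v_T(j)$; (2) for all $i,j\in[n]$, $p_i<p_j+1$ if and only if $v_T(i)\prec_T v^1_T(j)$; (3) for all $i,j\in[n]$, $p_i=p_j+1$ if and only if $v_T(i)=v^1_T(j)$ and $v^1_T(j)$ is a captive node. The map $T\mapsto \Phi(T)$ is a bijection from the set of $[n]$-decorated binary trees to the set of faces of the Catalan arrangement in $\mathbb{R}^n$. Moreover, $T$ has exactly $k$ free nodes if and only if $\Phi(T)$ is a face of dimension $k$.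
   Context: $[n]=\{1,\dots,n\}$. A face of a finite arrangement of affine hyperplanes in $\mathbb{R}^n$ is a nonempty set obtained by choosing, for each hyperplane $\{a\cdot x=c\}$ of the arrangement, one of $a\cdot x<c$, $a\cdot x=c$, $a\cdot x>c$, and taking the solution set of the resulting system; its dimension is the dimension of its affine span. The Catalan arrangement in $\mathbb{R}^n$ consists of the hyperplanes $x_i-x_j=0$ and $x_i-x_j=1$ for distinct $i,j\in[n]$. A binary tree is a rooted plane tree in which every vertex has 0 or 2 children; vertices with no children are leaves, the others are nodes; the first child of a node is its left child, the second its right child, and the corresponding edges are left and right edges. An internal edge is an edge between two nodes. An $[n]$-decorated binary tree is a binary tree in which each node is labeled by a nonempty subset of $[n]$, the labels forming a set partition of $[n]$, and each right internal edge is declared either solid or dashed (all other edges are solid). A captive node is a node joined to its parent by a dashed edge; a free node is a node that is not captive. For a vertex $v$, let $\rho(v)$ be the word in $\{E_0,E_1\}$ recording the path from the root to $v$ ($E_0$ = left edge, $E_1$ = right edge), and $\dot\rho(v)$ the number of right edges on it. For distinct vertices $v,w$, $v\prec_T w$ means: $\dot\rho(v)<\dot\rho(w)$, or $\dot\rho(v)=\dot\rho(w)$ and either $\rho(v)$ is a proper prefix of $\rho(w)$ or at the first position where they differ $\rho(v)$ has $E_1$ and $\rho(w)$ has $E_0$. $v\preceq_T w$ means $v\prec_T w$ or $v=w$. For $i\in[n]$, $v_T(i)$ is the node whose label contains $i$ and $v^1_T(i)$ is the right child of $v_T(i)$. *)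

theory Defs
  imports "HOL-Analysis.Analysis" "HOL-Library.Sublist"
begin

subsection \<open>Hyperplane arrangements and their faces\<close>

text \<open>
  An arrangement is a set of hyperplanes, each one a set of points.  The three sides of a hyperplane
  do not depend, as an unordered triple, on the equation chosen to define it.
\<close>

definition sides :: "'a::euclidean_space set \<Rightarrow> 'a set set" where
  "sides H = {S. \<exists>a c. a \<noteq> 0 \<and> H = {x. a \<bullet> x = c} \<and>
     (S = {x. a \<bullet> x < c} \<or> S = {x. a \<bullet> x = c} \<or> S = {x. a \<bullet> x > c})}"

definition faces :: "'a::euclidean_space set set \<Rightarrow> 'a set set" where
  "faces \<A> = {F. F \<noteq> {} \<and> (\<exists>\<sigma>. (\<forall>H\<in>\<A>. \<sigma> H \<in> sides H) \<and> F = (\<Inter>H\<in>\<A>. \<sigma> H))}"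

text \<open>
  The finite index type \<open>'n\<close> plays the role of $[n]$; only the distinctness of indices matters.
\<close>

definition catalan_arrangement :: "(real^'n) set set" where
  "catalan_arrangement =
     {{x. x $ i - x $ j = 0} | i j. i \<noteq> j} \<union> {{x. x $ i - x $ j = 1} | i j. i \<noteq> j}"


subsection \<open>Decorated binary trees\<close>

datatype edge_style = Solid | Dashed

text \<open>
  \<open>Node l A e r\<close> is a node with label \<open>A\<close>, left subtree \<open>l\<close> and right subtree \<open>r\<close>, where \<open>e\<close> is the
  style of its right edge.  If \<open>r\<close> is a leaf, that edge is not internal, and
  \<open>decorated_trees\<close> below requires it to be solid.
\<close>

datatype 'a btree = Leaf | Node "'a btree" "'a set" edge_style "'a btree"

text \<open>
  A vertex \<open>v\<close> is identified with the word $\rho(v)$ of edges on the path from the root to it.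
\<close>

datatype edge = E0 | E1

type_synonym vertex = "edge list"

fun subtree_at :: "'a btree \<Rightarrow> vertex \<Rightarrow> 'a btree option" where
  "subtree_at T [] = Some T"
| "subtree_at Leaf (_ # _) = None"
| "subtree_at (Node l A e r) (E0 # w) = subtree_at l w"
| "subtree_at (Node l A e r) (E1 # w) = subtree_at r w"

definition nodes :: "'a btree \<Rightarrow> vertex set" where
  "nodes T = {v. \<exists>l A e r. subtree_at T v = Some (Node l A e r)}"

definition node_label :: "'a btree \<Rightarrow> vertex \<Rightarrow> 'a set" where
  "node_label T v = (case subtree_at T v of Some (Node l A e r) \<Rightarrow> A | _ \<Rightarrow> {})"

definition decorated_trees :: "'a set \<Rightarrow> 'a btree set" where
  "decorated_trees S = {T.
     inj_on (node_label T) (nodes T) \<and>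
     partition_on S (node_label T ` nodes T) \<and>
     (\<forall>v l A e. subtree_at T v = Some (Node l A e Leaf) \<longrightarrow> e = Solid)}"

definition captive_nodes :: "'a btree \<Rightarrow> vertex set" where
  "captive_nodes T = {v \<in> nodes T. \<exists>u l A r. v = u @ [E1] \<and> subtree_at T u = Some (Node l A Dashed r)}"

definition free_nodes :: "'a btree \<Rightarrow> vertex set" where
  "free_nodes T = nodes T - captive_nodes T"


subsection \<open>The order on vertices\<close>

definition num_right :: "vertex \<Rightarrow> nat" where
  "num_right v = count_list v E1"

definition vprec :: "vertex \<Rightarrow> vertex \<Rightarrow> bool" (infix "\<prec>\<^sub>T" 50) where
  "v \<prec>\<^sub>T w \<longleftrightarrow> num_right v < num_right w \<or>
     num_right v = num_right w \<and>
       (strict_prefix v w \<or> (\<exists>u v' w'. v = u @ E1 # v' \<and> w = u @ E0 # w'))"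

definition vpreceq :: "vertex \<Rightarrow> vertex \<Rightarrow> bool" (infix "\<preceq>\<^sub>T" 50) where
  "v \<preceq>\<^sub>T w \<longleftrightarrow> v \<prec>\<^sub>T w \<or> v = w"

definition node_of :: "'a btree \<Rightarrow> 'a \<Rightarrow> vertex" where
  "node_of T i = (THE v. v \<in> nodes T \<and> i \<in> node_label T v)"

definition right_child_of :: "'a btree \<Rightarrow> 'a \<Rightarrow> vertex" where
  "right_child_of T i = node_of T i @ [E1]"


subsection \<open>The face associated with a tree\<close>

definition tree_point :: "'n btree \<Rightarrow> real^'n \<Rightarrow> bool" where
  "tree_point T p \<longleftrightarrow>
     (\<forall>i j. p $ i \<le> p $ j \<longleftrightarrow> node_of T i \<preceq>\<^sub>T node_of T j) \<and>
     (\<forall>i j. p $ i < p $ j + 1 \<longleftrightarrow> node_of T i \<prec>\<^sub>T right_child_of T j) \<and>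
     (\<forall>i j. p $ i = p $ j + 1 \<longleftrightarrow>
        node_of T i = right_child_of T j \<and> right_child_of T j \<in> captive_nodes T)"

definition is_face_of_tree :: "'n::finite btree \<Rightarrow> (real^'n) set \<Rightarrow> bool" where
  "is_face_of_tree T F \<longleftrightarrow> F \<in> faces catalan_arrangement \<and> (\<forall>p. p \<in> F \<longleftrightarrow> tree_point T p)"

definition \<Phi> :: "'n::finite btree \<Rightarrow> (real^'n) set" where
  "\<Phi> T = (THE F. is_face_of_tree T F)"

end

theory Submission imports Defs begin

text \<open>
  Writing a vertex as $E_0^{a_0} E_1 E_0^{a_1} E_1 \cdots E_1 E_0^{a_k}$, the order on vertices is
  the shortlex order on the sequences $(a_0, \ldots, a_k)$.  Hence appending $E_1$ is strictly
  increasing and $w E_0$ is the immediate successor of $w$.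

  A point of the face of \<open>T\<close> has at a node \<open>v\<close> the coordinate \<open>num_right v\<close> plus an offset in
  $[0, 1)$ found by repeatedly bisecting intervals along the path to \<open>v\<close>.  Conversely the distinct
  coordinates of a point, taken in increasing order, have forced positions in the tree: a new
  maximum $M$ is either the left child of the preceding value, or, if some $x + 1$ separates the two,
  the right child of the largest $x$ with $x + 1 \le M$.

  A face is relatively open in the affine space on which the coordinates of all indices with the
  same nearest free ancestor differ by fixed constants, so its dimension counts the free nodes.
\<close>

subsection \<open>The order on words\<close>

lemma num_right_simps [simp]:
  "num_right [] = 0" "num_right (E0 # v) = num_right v" "num_right (E1 # v) = Suc (num_right v)"
  "num_right (v @ w) = num_right v + num_right w"
  by (simp_all add: num_right_def)

lemma vprec_Nil2 [simp]: "\<not> v \<prec>\<^sub>T []"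
  by (auto simp: vprec_def)

lemma vprec_Nil [simp]: "[] \<prec>\<^sub>T w \<longleftrightarrow> w \<noteq> []"
  by (cases w) (auto simp: vprec_def)

lemma vprec_Cons_same [simp]: "e # v \<prec>\<^sub>T e # w \<longleftrightarrow> v \<prec>\<^sub>T w"
proof -
  have "(\<exists>u v' w'. e # v = u @ E1 # v' \<and> e # w = u @ E0 # w') \<longleftrightarrow>
        (\<exists>u v' w'. v = u @ E1 # v' \<and> w = u @ E0 # w')" (is "?L \<longleftrightarrow> ?R")
  proof
    assume ?L
    then obtain u v' w' where "e # v = u @ E1 # v'" "e # w = u @ E0 # w'" by blast
    then show ?R by (cases u) auto
  next
    assume ?R
    then obtain u v' w' where "v = u @ E1 # v'" "w = u @ E0 # w'" by blast
    then have "e # v = (e # u) @ E1 # v'" "e # w = (e # u) @ E0 # w'" by auto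
    then show ?L by blast
  qed
  then show ?thesis
    by (cases e) (auto simp: vprec_def)
qed

lemma vprec_E0_E1 [simp]: "E0 # v \<prec>\<^sub>T E1 # w \<longleftrightarrow> num_right v \<le> num_right w"
  by (auto simp: vprec_def Cons_eq_append_conv)

lemma vprec_E1_E0 [simp]: "E1 # v \<prec>\<^sub>T E0 # w \<longleftrightarrow> Suc (num_right v) \<le> num_right w"
  by (auto simp: vprec_def Cons_eq_append_conv)

lemma vprec_num_right: "v \<prec>\<^sub>T w \<Longrightarrow> num_right v \<le> num_right w"
  by (auto simp: vprec_def)

lemma num_right_less_vprec: "num_right v < num_right w \<Longrightarrow> v \<prec>\<^sub>T w"
  by (auto simp: vprec_def)

lemma vprec_irrefl [simp]: "\<not> v \<prec>\<^sub>T v"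
  by (induction v) auto

lemma vprec_linear: "v \<prec>\<^sub>T w \<or> v = w \<or> w \<prec>\<^sub>T v"
proof (induction v arbitrary: w)
  case Nil
  then show ?case by simp
next
  case (Cons a v)
  then show ?case
  proof (cases w)
    case (Cons b w')
    then show ?thesis using Cons.IH[of w'] by (cases a; cases b) auto
  qed simp
qed

lemma vprec_trans [trans]: "u \<prec>\<^sub>T v \<Longrightarrow> v \<prec>\<^sub>T w \<Longrightarrow> u \<prec>\<^sub>T w"
proof (induction u arbitrary: v w)
  case Nil
  then show ?case by (cases w) auto
next
  case (Cons a u)
  obtain b v' where v: "v = b # v'" using Cons.prems(1) by (cases v) auto
  obtain c w' where w: "w = c # w'" using Cons.prems(2) by (cases w) auto
  show ?case
    using Cons.prems Cons.IH[of v' w'] vprec_num_right[of u v'] vprec_num_right[of v' w']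
    unfolding v w by (cases a; cases b; cases c) (auto intro: num_right_less_vprec)
qed

lemma vprec_asym: "v \<prec>\<^sub>T w \<Longrightarrow> \<not> w \<prec>\<^sub>T v"
  using vprec_trans vprec_irrefl by blast

lemma not_vprec: "\<not> v \<prec>\<^sub>T w \<longleftrightarrow> w \<preceq>\<^sub>T v"
  using vprec_linear vprec_asym vprec_irrefl unfolding vpreceq_def by blast

lemma not_vpreceq: "\<not> v \<preceq>\<^sub>T w \<longleftrightarrow> w \<prec>\<^sub>T v"
  using not_vprec by blast

lemma vpreceq_antisym: "v \<preceq>\<^sub>T w \<Longrightarrow> w \<preceq>\<^sub>T v \<Longrightarrow> v = w"
  using vprec_asym unfolding vpreceq_def by blast

lemma vprec_append: "w \<noteq> [] \<Longrightarrow> v \<prec>\<^sub>T v @ w"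
  by (induction v) auto

lemma vprec_snoc_E1 [simp]: "v @ [E1] \<prec>\<^sub>T w @ [E1] \<longleftrightarrow> v \<prec>\<^sub>T w"
proof (induction v arbitrary: w)
  case Nil
  then show ?case
  proof (cases w)
    case (Cons b w')
    then show ?thesis by (cases b) auto
  qed simp
next
  case (Cons a v)
  then show ?case
  proof (cases w)
    case Nil
    then show ?thesis by (cases a) auto
  next
    case (Cons b w')
    then show ?thesis using Cons.IH[of w'] by (cases a; cases b) auto
  qed
qed

lemma vprec_snoc_E0_iff: "x \<prec>\<^sub>T w @ [E0] \<longleftrightarrow> x \<preceq>\<^sub>T w"
proof (induction w arbitrary: x)
  case Nil
  show ?case
  proof (cases x)
    case (Cons a y)
    then show ?thesis by (cases a) (auto simp: vpreceq_def)
  qed (auto simp: vpreceq_def)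
next
  case (Cons b w)
  show ?case
  proof (cases x)
    case (Cons a y)
    then show ?thesis using Cons.IH[of y] by (cases a; cases b) (auto simp: vpreceq_def)
  qed (auto simp: vpreceq_def)
qed

lemma snoc_E0_vprec_snoc_E1: "w @ [E0] \<prec>\<^sub>T u @ [E1] \<longleftrightarrow> w \<prec>\<^sub>T u @ [E1]"
  by (metis append1_eq_conv edge.distinct(1) vprec_snoc_E0_iff vprec_linear not_vprec vpreceq_def)

lemma snoc_E1_vpreceq_append_E0s:
  assumes "u @ [E1] \<preceq>\<^sub>T c @ replicate a E0"
  shows "u @ [E1] \<preceq>\<^sub>T c"
  using assms
proof (induction a)
  case (Suc a)
  have "\<not> (c @ replicate a E0) @ [E0] \<prec>\<^sub>T u @ [E1]"
    using Suc.prems not_vprec by (simp add: replicate_append_same)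
  then show ?case
    using Suc.IH not_vprec snoc_E0_vprec_snoc_E1 by blast
qed simp

lemma trailing_E0s_decomp:
  obtains c a where "v = c @ replicate a E0" "c = [] \<or> (\<exists>u. c = u @ [E1])"
proof (induction v arbitrary: thesis rule: rev_induct)
  case Nil
  show ?case by (rule Nil[of "[]" 0]) auto
next
  case (snoc x v)
  show ?case
  proof (cases x)
    case E0
    obtain c a where "v = c @ replicate a E0" "c = [] \<or> (\<exists>u. c = u @ [E1])"
      using snoc.IH by blast
    then show ?thesis
      by (intro snoc.prems[of c "Suc a"]) (auto simp: E0 replicate_append_same)
  next
    case E1
    show ?thesis by (rule snoc.prems[of "v @ [x]" 0]) (auto simp: E1)
  qed
qed

subsection \<open>Trees\<close>

lemma nodes_simps [simp]:
  "v \<notin> nodes Leaf" "[] \<in> nodes (Node l A e r)"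
  "E0 # v \<in> nodes (Node l A e r) \<longleftrightarrow> v \<in> nodes l"
  "E1 # v \<in> nodes (Node l A e r) \<longleftrightarrow> v \<in> nodes r"
  by (cases v; auto simp: nodes_def)+

lemma node_label_simps [simp]:
  "node_label (Node l A e r) [] = A"
  "node_label (Node l A e r) (E0 # v) = node_label l v"
  "node_label (Node l A e r) (E1 # v) = node_label r v"
  by (auto simp: node_label_def)

definition dashed :: "'a btree \<Rightarrow> vertex \<Rightarrow> bool" where
  "dashed T v \<longleftrightarrow> (\<exists>l A r. subtree_at T v = Some (Node l A Dashed r))"

lemma dashed_simps [simp]:
  "\<not> dashed Leaf v" "dashed (Node l A e r) [] \<longleftrightarrow> e = Dashed"
  "dashed (Node l A e r) (E0 # v) \<longleftrightarrow> dashed l v"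
  "dashed (Node l A e r) (E1 # v) \<longleftrightarrow> dashed r v"
  by (cases v; auto simp: dashed_def)+

lemma captive_nodes_iff:
  "v \<in> captive_nodes T \<longleftrightarrow> v \<in> nodes T \<and> (\<exists>u. v = u @ [E1] \<and> dashed T u)"
  by (auto simp: captive_nodes_def dashed_def)

lemma nodes_prefix_closed: "v @ w \<in> nodes T \<Longrightarrow> v \<in> nodes T"
proof (induction v arbitrary: T)
  case Nil
  then show ?case by (cases T) auto
next
  case (Cons a v)
  then show ?case by (cases T; cases a) auto
qed

lemma subtree_at_snoc_E1:
  "subtree_at T v = Some (Node l A e r) \<Longrightarrow> subtree_at T (v @ [E1]) = Some r"
proof (induction v arbitrary: T)
  case Nil
  then show ?case by simp
next
  case (Cons a v)
  then show ?case by (cases T; cases a) auto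
qed

lemma btree_eqI:
  assumes "nodes T = nodes T'" "\<And>v. v \<in> nodes T \<Longrightarrow> node_label T v = node_label T' v"
    "\<And>v. dashed T v \<longleftrightarrow> dashed T' v"
  shows "T = T'"
  using assms
proof (induction T arbitrary: T')
  case Leaf
  then have "[] \<notin> nodes T'" by (metis nodes_simps(1))
  then show ?case by (cases T') auto
next
  case (Node l A e r)
  obtain l' A' e' r' where T': "T' = Node l' A' e' r'"
    using Node.prems(1) nodes_simps(1,2) by (metis btree.exhaust)
  have N: "v \<in> nodes (Node l A e r) \<longleftrightarrow> v \<in> nodes (Node l' A' e' r')" for v
    using Node.prems(1) T' by simp
  note L = Node.prems(2)[unfolded T'] and D = Node.prems(3)[unfolded T']
  have "nodes l = nodes l'" "nodes r = nodes r'"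
    using N[of "E0 # _"] N[of "E1 # _"] by auto
  moreover have "node_label l v = node_label l' v" if "v \<in> nodes l" for v
    using L[of "E0 # v"] that by simp
  moreover have "node_label r v = node_label r' v" if "v \<in> nodes r" for v
    using L[of "E1 # v"] that by simp
  moreover have "dashed l v = dashed l' v" "dashed r v = dashed r' v" for v
    using D[of "E0 # v"] D[of "E1 # v"] by auto
  moreover have "A = A'" using L[of "[]"] by simp
  moreover have "e = e'" using D[of "[]"] by (cases e; cases e') auto
  ultimately show ?case using Node.IH unfolding T' by blast
qed

context
  fixes T :: "'n btree"
  assumes T: "T \<in> decorated_trees UNIV"
begin

lemma node_label_ex1: "\<exists>!v. v \<in> nodes T \<and> i \<in> node_label T v"
proof -
  have inj: "inj_on (node_label T) (nodes T)" and part: "partition_on UNIV (node_label T ` nodes T)"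
    using T by (auto simp: decorated_trees_def)
  obtain v where v: "v \<in> nodes T" "i \<in> node_label T v"
    using part by (auto simp: partition_on_def)
  show ?thesis
  proof (rule ex1I[of _ v])
    fix w assume w: "w \<in> nodes T \<and> i \<in> node_label T w"
    have "node_label T w = node_label T v"
      using part v w by (auto simp: partition_on_def disjoint_def)
    then show "w = v" using inj v w by (auto dest: inj_onD)
  qed (use v in auto)
qed

lemma node_of_in_nodes: "node_of T i \<in> nodes T"
  and in_node_label_node_of: "i \<in> node_label T (node_of T i)"
  using theI'[OF node_label_ex1[of i]] unfolding node_of_def by auto

lemma node_of_eqI: "v \<in> nodes T \<Longrightarrow> i \<in> node_label T v \<Longrightarrow> node_of T i = v"
  using node_label_ex1 node_of_in_nodes in_node_label_node_of by blast

lemma nodes_eq_range_node_of: "nodes T = range (node_of T)"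
proof -
  have "v \<in> range (node_of T)" if "v \<in> nodes T" for v
  proof -
    have "node_label T v \<noteq> {}"
      using T that by (auto simp: decorated_trees_def partition_on_def)
    then show ?thesis using node_of_eqI[OF that] by blast
  qed
  then show ?thesis using node_of_in_nodes by auto
qed

lemma node_label_eq: "v \<in> nodes T \<Longrightarrow> node_label T v = {i. node_of T i = v}"
  using node_of_eqI in_node_label_node_of by blast

lemma dashed_iff_captive: "dashed T v \<longleftrightarrow> v @ [E1] \<in> captive_nodes T"
proof
  assume d: "dashed T v"
  then obtain l A r where s: "subtree_at T v = Some (Node l A Dashed r)"
    by (auto simp: dashed_def)
  have "r \<noteq> Leaf" using T s by (force simp: decorated_trees_def)
  then have "v @ [E1] \<in> nodes T"
    using subtree_at_snoc_E1[OF s] by (cases r) (auto simp: nodes_def)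
  then show "v @ [E1] \<in> captive_nodes T" using d by (auto simp: captive_nodes_iff)
qed (auto simp: captive_nodes_iff)

end

subsection \<open>A point for every tree\<close>

text \<open>
  The subtree \<open>T\<close> occupies the interval $[x, y)$: its root sits at $x$, its left subtree occupies
  the upper half, and its right subtree the lower half, starting at $x$ itself only if dashed.
\<close>

fun pos :: "'a btree \<Rightarrow> real \<Rightarrow> real \<Rightarrow> vertex \<Rightarrow> real" where
  "pos T x y [] = x"
| "pos Leaf x y (_ # _) = x"
| "pos (Node l A e r) x y (E0 # w) = pos l ((x + y) / 2) y w"
| "pos (Node l A e r) x y (E1 # w) =
     pos r (if e = Dashed then x else (3 * x + y) / 4) ((x + y) / 2) w"

lemma pos_bounds: "x < y \<Longrightarrow> x \<le> pos T x y w \<and> pos T x y w < y"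
proof (induction T x y w rule: pos.induct)
  case (3 l A e r x y w)
  then show ?case by (auto simp: field_simps)
next
  case (4 l A e r x y w)
  then show ?case by (cases "e = Dashed") (auto simp: field_simps)
qed auto

lemma pos_left: "x < y \<Longrightarrow> (x + y) / 2 \<le> pos (Node l A e r) x y (E0 # w)"
  using pos_bounds[of "(x + y) / 2" y l w] by (simp add: field_simps)

lemma pos_right:
  "x < y \<Longrightarrow> pos (Node l A e r) x y (E1 # w) < (x + y) / 2"
  using pos_bounds[of x "(x + y) / 2" r w] pos_bounds[of "(3 * x + y) / 4" "(x + y) / 2" r w]
  by (auto simp: field_simps)

lemma pos_strict_mono:
  assumes "x < y" "v \<in> nodes T" "w \<in> nodes T" "num_right v = num_right w" "v \<prec>\<^sub>T w"
  shows "pos T x y v < pos T x y w"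
  using assms
proof (induction v arbitrary: T x y w)
  case Nil
  obtain l A e r where T: "T = Node l A e r" using Nil.prems by (cases T) auto
  obtain a w' where "w = a # w'" using Nil.prems by (cases w) auto
  then have w: "w = E0 # w'" using Nil.prems by (cases a) auto
  show ?case using pos_left[of x y l A e r w'] Nil.prems(1) by (simp add: T w)
next
  case (Cons a v)
  obtain l A e r where T: "T = Node l A e r" using Cons.prems by (cases T) auto
  obtain b w' where w: "w = b # w'" using Cons.prems by (cases w) auto
  consider "a = E0" "b = E0" | "a = E1" "b = E1" | "a = E1" "b = E0" | "a = E0" "b = E1"
    by (cases a; cases b) auto
  then show ?case
  proof cases
    case 1
    then show ?thesis using Cons.prems Cons.IH[of "(x + y) / 2" y l w'] by (auto simp: T w)
  next
    case 2
    then show ?thesis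
      using Cons.prems Cons.IH[of _ "(x + y) / 2" r w'] by (auto simp: T w)
  next
    case 3
    show ?thesis using pos_left[of x y l A e r w'] pos_right[of x y l A e r v] Cons.prems(1)
      unfolding T w 3 by linarith
  next
    case 4
    then show ?thesis using Cons.prems by (auto simp: T w)
  qed
qed

lemma pos_next_level:
  assumes "x < y" "v \<in> nodes T" "w \<in> nodes T" "num_right w = Suc (num_right v)"
  shows "(w \<prec>\<^sub>T v @ [E1] \<longrightarrow> pos T x y w < pos T x y v) \<and>
    (v @ [E1] \<prec>\<^sub>T w \<longrightarrow> pos T x y v < pos T x y w) \<and>
    (w = v @ [E1] \<longrightarrow> (if dashed T v then pos T x y w = pos T x y v else pos T x y v < pos T x y w))"
  using assms
proof (induction v arbitrary: T x y w)
  case Nil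
  obtain l A e r where T: "T = Node l A e r" using Nil.prems by (cases T) auto
  obtain b w' where w: "w = b # w'" using Nil.prems by (cases w) auto
  show ?case
  proof (cases b)
    case E0
    then show ?thesis using pos_left[of x y l A e r w'] Nil.prems by (auto simp: T w)
  next
    case E1
    define x' where "x' = (if e = Dashed then x else (3 * x + y) / 4)"
    have x': "x \<le> x'" "x' < (x + y) / 2" "e \<noteq> Dashed \<longrightarrow> x < x'"
      using Nil.prems(1) by (auto simp: x'_def)
    have "x' < pos r x' ((x + y) / 2) w'" if "w' \<noteq> []"
      using pos_strict_mono[of x' "(x + y) / 2" "[]" r w'] x' Nil.prems that nodes_prefix_closed[of "[]"]
      by (auto simp: T w E1)
    moreover have "pos T x y w = pos r x' ((x + y) / 2) w'" by (simp add: T w E1 x'_def)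
    moreover have "e = Dashed \<Longrightarrow> x' = x" by (simp add: x'_def)
    ultimately show ?thesis using x' Nil.prems(1) by (cases "w' = []") (auto simp: T w E1)
  qed
next
  case (Cons a v)
  obtain l A e r where T: "T = Node l A e r" using Cons.prems by (cases T) auto
  obtain b w' where w: "w = b # w'" using Cons.prems by (cases w) auto
  consider "a = E0" "b = E0" | "a = E1" "b = E1" | "a = E1" "b = E0" | "a = E0" "b = E1"
    by (cases a; cases b) auto
  then show ?case
  proof cases
    case 1
    then show ?thesis using Cons.prems Cons.IH[of "(x + y) / 2" y l w'] by (auto simp: T w)
  next
    case 2
    define x' where "x' = (if e = Dashed then x else (3 * x + y) / 4)"
    have "x' < (x + y) / 2" using Cons.prems(1) by (auto simp: x'_def)
    moreover have "pos T x y (E1 # u) = pos r x' ((x + y) / 2) u" for u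
      by (simp add: T x'_def)
    ultimately show ?thesis
      using Cons.prems Cons.IH[of x' "(x + y) / 2" r w']
      unfolding 2 w by (simp add: T del: pos.simps split: if_splits)
  next
    case 3
    have "pos T x y (a # v) < pos T x y w"
      using pos_left[of x y l A e r w'] pos_right[of x y l A e r v] Cons.prems(1)
      unfolding T w 3 by linarith
    then show ?thesis using Cons.prems by (auto simp: T w 3)
  next
    case 4
    have "pos T x y w < pos T x y (a # v)"
      using pos_left[of x y l A e r v] pos_right[of x y l A e r w'] Cons.prems(1)
      unfolding T w 4 by linarith
    then show ?thesis using Cons.prems by (auto simp: T w 4)
  qed
qed

lemma tree_point_exists:
  fixes T :: "'n::finite btree"
  assumes T: "T \<in> decorated_trees UNIV"
  obtains p where "tree_point T p"
proof -
  define q where "q v = real (num_right v) + pos T 0 1 v" for v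
  have b: "0 \<le> pos T 0 1 v" "pos T 0 1 v < 1" for v using pos_bounds[of 0 1 T v] by auto
  have mono: "q v < q w" if "v \<prec>\<^sub>T w" "v \<in> nodes T" "w \<in> nodes T" for v w
  proof (cases "num_right v = num_right w")
    case True
    then show ?thesis using pos_strict_mono[of 0 1 v T w] that by (simp add: q_def)
  next
    case False
    then have "real (num_right v) + 1 \<le> real (num_right w)"
      using vprec_num_right[OF that(1)] by linarith
    then show ?thesis using b[of v] b[of w] unfolding q_def by linarith
  qed
  then have le: "q v \<le> q w \<longleftrightarrow> v \<preceq>\<^sub>T w" if "v \<in> nodes T" "w \<in> nodes T" for v w
    using that by (metis leD less_imp_le not_vpreceq order_refl vpreceq_def)
  have lt1: "q w < q v + 1" if "w \<prec>\<^sub>T v @ [E1]" "v \<in> nodes T" "w \<in> nodes T" for v w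
  proof (cases "num_right w = Suc (num_right v)")
    case True
    then show ?thesis using pos_next_level[of 0 1 v T w] that by (simp add: q_def)
  next
    case False
    then have "real (num_right w) \<le> real (num_right v)"
      using vprec_num_right[OF that(1)] by simp
    then show ?thesis using b[of v] b[of w] unfolding q_def by linarith
  qed
  have gt1: "q v + 1 < q w" if "v @ [E1] \<prec>\<^sub>T w" "v \<in> nodes T" "w \<in> nodes T" for v w
  proof (cases "num_right w = Suc (num_right v)")
    case True
    then show ?thesis using pos_next_level[of 0 1 v T w] that by (simp add: q_def)
  next
    case False
    then have "real (num_right v) + 2 \<le> real (num_right w)"
      using vprec_num_right[OF that(1)] by simp
    then show ?thesis using b[of v] b[of w] unfolding q_def by linarith
  qed
  have eq1: "if dashed T v then q (v @ [E1]) = q v + 1 else q v + 1 < q (v @ [E1])"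
    if "v \<in> nodes T" "v @ [E1] \<in> nodes T" for v
    using pos_next_level[of 0 1 v T "v @ [E1]"] that by (auto simp: q_def)
  have iff1: "(q w < q v + 1 \<longleftrightarrow> w \<prec>\<^sub>T v @ [E1]) \<and> (q w = q v + 1 \<longleftrightarrow> w = v @ [E1] \<and> dashed T v)"
    if "v \<in> nodes T" "w \<in> nodes T" for v w
  proof -
    consider "w \<prec>\<^sub>T v @ [E1]" | "w = v @ [E1]" | "v @ [E1] \<prec>\<^sub>T w" using vprec_linear by blast
    then show ?thesis
    proof cases
      case 1
      then show ?thesis using lt1[OF 1 that] by auto
    next
      case 2
      then show ?thesis using eq1[of v] that by (simp split: if_splits)
    next
      case 3
      then show ?thesis using gt1[OF 3 that] vprec_asym[OF 3] by auto
    qed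
  qed
  have "tree_point T (\<chi> i. q (node_of T i))"
    unfolding tree_point_def right_child_of_def
    by (simp add: le iff1 node_of_in_nodes[OF T]) (simp add: dashed_iff_captive[OF T] conj_commute cong: conj_cong)
  then show thesis using that by blast
qed

subsection \<open>The tree of a point is unique\<close>

lemma decorated_tree_eqI:
  assumes T: "T \<in> decorated_trees UNIV" and T': "T' \<in> decorated_trees UNIV"
    and n: "\<And>i. node_of T i = node_of T' i" and c: "captive_nodes T = captive_nodes T'"
  shows "T = T'"
proof (rule btree_eqI)
  show N: "nodes T = nodes T'"
    using n nodes_eq_range_node_of[OF T] nodes_eq_range_node_of[OF T'] by auto
  show "node_label T v = node_label T' v" if "v \<in> nodes T" for v
    using that n N node_label_eq[OF T] node_label_eq[OF T'] by auto
  show "dashed T v = dashed T' v" for v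
    using c dashed_iff_captive[OF T] dashed_iff_captive[OF T'] by auto
qed

lemma tree_point_less: "tree_point T p \<Longrightarrow> p $ i < p $ j \<longleftrightarrow> node_of T i \<prec>\<^sub>T node_of T j"
  unfolding tree_point_def by (metis not_le not_vpreceq)

lemma tree_point_eq: "tree_point T p \<Longrightarrow> p $ i = p $ j \<longleftrightarrow> node_of T i = node_of T j"
  unfolding tree_point_def by (metis order.antisym order.refl vpreceq_antisym vpreceq_def)

lemma tree_point_le_plus_1:
  "tree_point T p \<Longrightarrow> p $ j + 1 \<le> p $ i \<longleftrightarrow> node_of T j @ [E1] \<preceq>\<^sub>T node_of T i"
  unfolding tree_point_def right_child_of_def by (metis not_le not_vprec)

lemma tree_point_eq_plus_1:
  "tree_point T p \<Longrightarrow> p $ i = p $ j + 1 \<longleftrightarrow>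
     node_of T i = node_of T j @ [E1] \<and> node_of T j @ [E1] \<in> captive_nodes T"
  unfolding tree_point_def right_child_of_def by blast

text \<open>If all smaller coordinates sit at the same nodes of both trees, then so does \<open>i\<close>: the last
  right edge on the path to the node of \<open>i\<close> is determined by which \<open>p $ j + 1\<close> lie below \<open>p $ i\<close>,
  and of two words differing only in the number of trailing left edges the shorter one would
  already be occupied.\<close>

lemma tree_point_stem_vpreceq:
  fixes T T' :: "'n::finite btree"
  assumes T: "T \<in> decorated_trees UNIV" and p: "tree_point T p" and p': "tree_point T' p"
    and IH: "\<And>j. p $ j < p $ i \<Longrightarrow> node_of T j = node_of T' j"
    and v: "node_of T i = c @ replicate a E0" and c: "c = [] \<or> (\<exists>u. c = u @ [E1])"
    and v': "node_of T' i = c' @ replicate a' E0"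
  shows "c \<preceq>\<^sub>T c'"
  using c
proof
  assume "\<exists>u. c = u @ [E1]"
  then obtain u where u: "c = u @ [E1]" by blast
  have "u \<in> nodes T"
    using node_of_in_nodes[OF T, of i] nodes_prefix_closed[of u] by (simp add: v u)
  then obtain j where j: "u = node_of T j" using nodes_eq_range_node_of[OF T] by auto
  have "u \<prec>\<^sub>T node_of T i"
    unfolding v u append_assoc by (rule vprec_append) simp
  then have "p $ j < p $ i" using tree_point_less[OF p] by (simp add: j)
  then have j': "u = node_of T' j" using IH j by simp
  have "u @ [E1] \<preceq>\<^sub>T node_of T i"
    unfolding v u vpreceq_def using vprec_append[of "replicate a E0" "u @ [E1]"]
    by (cases a) auto
  then have "p $ j + 1 \<le> p $ i" using tree_point_le_plus_1[OF p] j by simp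
  then have "u @ [E1] \<preceq>\<^sub>T c' @ replicate a' E0" using tree_point_le_plus_1[OF p'] j' v' by simp
  then show ?thesis using snoc_E1_vpreceq_append_E0s u by blast
qed (auto simp: vpreceq_def)

lemma tree_point_short_stem:
  fixes T T' :: "'n::finite btree"
  assumes T: "T \<in> decorated_trees UNIV" and T': "T' \<in> decorated_trees UNIV"
    and p: "tree_point T p" and p': "tree_point T' p"
    and IH: "\<And>j. p $ j < p $ i \<Longrightarrow> node_of T j = node_of T' j"
    and v: "node_of T i = c @ replicate a E0" and v': "node_of T' i = c @ replicate a' E0"
  shows "a' \<le> a"
proof (rule ccontr)
  assume "\<not> a' \<le> a"
  then obtain d where d: "a' = a + Suc d" by (metis less_iff_Suc_add not_le add_Suc_right)
  have v'd: "node_of T' i = node_of T i @ replicate (Suc d) E0"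
    unfolding v v' d replicate_add by simp
  then have "node_of T i \<in> nodes T'"
    using node_of_in_nodes[OF T', of i] nodes_prefix_closed by metis
  then obtain j where j: "node_of T i = node_of T' j" using nodes_eq_range_node_of[OF T'] by auto
  then have "node_of T' j \<prec>\<^sub>T node_of T' i" using vprec_append v'd by simp
  then have less: "p $ j < p $ i" using tree_point_less[OF p'] by blast
  then have "node_of T j = node_of T i" using IH j by simp
  then show False using less tree_point_eq[OF p] by (metis less_irrefl)
qed

lemma tree_point_unique:
  fixes T T' :: "'n::finite btree"
  assumes T: "T \<in> decorated_trees UNIV" and T': "T' \<in> decorated_trees UNIV"
    and p: "tree_point T p" and p': "tree_point T' p"
  shows "T = T'"
proof -
  have eq: "node_of T i = node_of T' i" for i
  proof (induction "card {j. p $ j < p $ i}" arbitrary: i rule: less_induct)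
    case less
    have IH: "node_of T j = node_of T' j" if "p $ j < p $ i" for j
    proof -
      have "card {k. p $ k < p $ j} < card {k. p $ k < p $ i}"
        by (rule psubset_card_mono) (use that in auto)
      then show ?thesis using less by blast
    qed
    then have IH': "\<And>j. p $ j < p $ i \<Longrightarrow> node_of T' j = node_of T j" by simp
    obtain c a where v: "node_of T i = c @ replicate a E0" "c = [] \<or> (\<exists>u. c = u @ [E1])"
      by (rule trailing_E0s_decomp)
    obtain c' a' where v': "node_of T' i = c' @ replicate a' E0" "c' = [] \<or> (\<exists>u. c' = u @ [E1])"
      by (rule trailing_E0s_decomp)
    have cc: "c' = c"
      using tree_point_stem_vpreceq[OF T p p' IH v v'(1)]
        tree_point_stem_vpreceq[OF T' p' p IH' v' v(1)] vpreceq_antisym by blast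
    have "a' = a"
      using tree_point_short_stem[OF T T' p p' IH v(1)] tree_point_short_stem[OF T' T p' p IH' _ v(1)] 
        v'(1) unfolding cc by (metis order.antisym)
    then show ?case using v(1) v'(1) cc by simp
  qed
  have sub: "captive_nodes S \<subseteq> captive_nodes S'"
    if S: "S \<in> decorated_trees UNIV" and q: "tree_point S p" and q': "tree_point S' p"
      and eq: "\<And>i. node_of S i = node_of S' i" for S S' :: "'n btree"
  proof
    fix v assume v: "v \<in> captive_nodes S"
    then obtain u where u: "v = u @ [E1]" "v \<in> nodes S" by (auto simp: captive_nodes_iff)
    obtain i where i: "v = node_of S i" using u nodes_eq_range_node_of[OF S] by auto
    obtain j where j: "u = node_of S j" using u nodes_eq_range_node_of[OF S] nodes_prefix_closed by blast
    have "p $ i = p $ j + 1" using tree_point_eq_plus_1[OF q] v u i j by simp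
    then show "v \<in> captive_nodes S'" using tree_point_eq_plus_1[OF q'] eq i by auto
  qed
  show ?thesis
    using decorated_tree_eqI[OF T T' eq] sub[OF T p p' eq] sub[OF T' p' p eq[symmetric]] by blast
qed

subsection \<open>A tree for every point\<close>

definition addressing :: "real set \<Rightarrow> (real \<Rightarrow> vertex) \<Rightarrow> bool" where
  "addressing V addr \<longleftrightarrow>
    (\<forall>y\<in>V. \<forall>z\<in>V. y < z \<longrightarrow> addr y \<prec>\<^sub>T addr z) \<and>
    (\<forall>y\<in>V. \<forall>z\<in>V. z < y + 1 \<longleftrightarrow> addr z \<prec>\<^sub>T addr y @ [E1]) \<and>
    (\<forall>y\<in>V. \<forall>z\<in>V. z = y + 1 \<longrightarrow> addr z = addr y @ [E1]) \<and>
    (\<forall>y\<in>V. \<forall>w e. addr y = w @ [e] \<longrightarrow> w \<in> addr ` V)"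

lemma addressingD:
  assumes "addressing V addr"
  shows "\<And>y z. y \<in> V \<Longrightarrow> z \<in> V \<Longrightarrow> y < z \<Longrightarrow> addr y \<prec>\<^sub>T addr z"
    and "\<And>y z. y \<in> V \<Longrightarrow> z \<in> V \<Longrightarrow> z < y + 1 \<longleftrightarrow> addr z \<prec>\<^sub>T addr y @ [E1]"
    and "\<And>y z. y \<in> V \<Longrightarrow> z \<in> V \<Longrightarrow> z = y + 1 \<Longrightarrow> addr z = addr y @ [E1]"
    and "\<And>y w e. y \<in> V \<Longrightarrow> addr y = w @ [e] \<Longrightarrow> w \<in> addr ` V"
  using assms unfolding addressing_def by blast+

lemma addressing_exists:
  assumes "finite V"
  shows "\<exists>addr. addressing V addr"
  using assms
proof (induction V rule: finite_linorder_max_induct)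
  case empty
  then show ?case by (simp add: addressing_def)
next
  case (insert M V)
  obtain addr where addr: "addressing V addr" using insert.IH by blast
  note mono = addressingD(1)[OF addr] and plus1 = addressingD(2)[OF addr]
    and eq = addressingD(3)[OF addr] and pre = addressingD(4)[OF addr]
  have M: "y < M" if "y \<in> V" for y using insert.hyps that by blast
  have mono_le: "addr y \<preceq>\<^sub>T addr z" if "y \<in> V" "z \<in> V" "y \<le> z" for y z
    using mono[of y z] that by (cases "y = z") (auto simp: vpreceq_def)
  have "\<exists>a. (\<forall>y\<in>V. addr y \<prec>\<^sub>T a) \<and> (\<forall>y\<in>V. M < y + 1 \<longleftrightarrow> a \<prec>\<^sub>T addr y @ [E1]) \<and>
      (\<forall>y\<in>V. M = y + 1 \<longrightarrow> a = addr y @ [E1]) \<and> (\<forall>w e. a = w @ [e] \<longrightarrow> w \<in> addr ` V)"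
  proof (cases "V = {}")
    case True
    then show ?thesis by (intro exI[of _ "[]"]) auto
  next
    case False
    define m where "m = Max V"
    have m: "m \<in> V" "\<And>y. y \<in> V \<Longrightarrow> y \<le> m"
      using False insert.hyps(1) by (auto simp: m_def)
    show ?thesis
    proof (cases "\<exists>x\<in>V. x + 1 \<le> M \<and> m < x + 1")
      case True
      define x where "x = Max {x \<in> V. x + 1 \<le> M}"
      have fin: "finite {x \<in> V. x + 1 \<le> M}" and ne: "{x \<in> V. x + 1 \<le> M} \<noteq> {}"
        using insert.hyps(1) True by auto
      have x: "x \<in> V" "x + 1 \<le> M" using Max_in[OF fin ne] by (auto simp: x_def)
      have xmax: "y \<le> x" if "y \<in> V" "y + 1 \<le> M" for y
        using Max_ge[OF fin] that by (auto simp: x_def)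
      have mx: "m < x + 1" using True xmax by fastforce
      have "addr y \<prec>\<^sub>T addr x @ [E1]" if "y \<in> V" for y
        using plus1[OF x(1) that] m(2)[OF that] mx by simp
      moreover have "M < y + 1 \<longleftrightarrow> addr x @ [E1] \<prec>\<^sub>T addr y @ [E1]" if y: "y \<in> V" for y
      proof -
        have "M < y + 1 \<longleftrightarrow> x < y" using xmax[OF y] x by linarith
        also have "\<dots> \<longleftrightarrow> addr x \<prec>\<^sub>T addr y"
          using mono[OF x(1) y] mono_le[OF y x(1)] not_vprec by (meson not_le)
        finally show ?thesis by simp
      qed
      moreover have "addr x @ [E1] = addr y @ [E1]" if "y \<in> V" "M = y + 1" for y
        using xmax[of y] x that by force
      ultimately show ?thesis using x by (intro exI[of _ "addr x @ [E1]"]) auto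
    next
      case False
      have iff: "M < y + 1 \<longleftrightarrow> m < y + 1" if "y \<in> V" for y
        using False that M[OF m(1)] by fastforce
      have "addr y \<prec>\<^sub>T addr m @ [E0]" if "y \<in> V" for y
        using mono_le[OF that m(1)] m(2)[OF that] vprec_snoc_E0_iff by blast
      moreover have "M < y + 1 \<longleftrightarrow> addr m @ [E0] \<prec>\<^sub>T addr y @ [E1]" if "y \<in> V" for y
        using iff[OF that] plus1[OF that m(1)] snoc_E0_vprec_snoc_E1 by blast
      moreover have "M \<noteq> y + 1" if "y \<in> V" for y
        using iff[OF that] M[OF m(1)] by auto
      ultimately show ?thesis using m(1) by (intro exI[of _ "addr m @ [E0]"]) auto
    qed
  qed
  then obtain a where "(\<forall>y\<in>V. addr y \<prec>\<^sub>T a) \<and> (\<forall>y\<in>V. M < y + 1 \<longleftrightarrow> a \<prec>\<^sub>T addr y @ [E1]) \<and>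
      (\<forall>y\<in>V. M = y + 1 \<longrightarrow> a = addr y @ [E1]) \<and> (\<forall>w e. a = w @ [e] \<longrightarrow> w \<in> addr ` V)" ..
  then have a: "\<And>y. y \<in> V \<Longrightarrow> addr y \<prec>\<^sub>T a"
    and a1: "\<And>y. y \<in> V \<Longrightarrow> M < y + 1 \<longleftrightarrow> a \<prec>\<^sub>T addr y @ [E1]"
    and ae: "\<And>y. y \<in> V \<Longrightarrow> M = y + 1 \<Longrightarrow> a = addr y @ [E1]"
    and ap: "\<And>w e. a = w @ [e] \<Longrightarrow> w \<in> addr ` V" by blast+
  have MV: "M \<notin> V" using M by blast
  define f where "f = addr(M := a)"
  have fM: "f M = a" and fV: "\<And>y. y \<in> V \<Longrightarrow> f y = addr y" using MV by (auto simp: f_def)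
  have r1: "f y \<prec>\<^sub>T f z" if "y \<in> insert M V" "z \<in> insert M V" "y < z" for y z
    using that M[of z] mono[of y z] a by (auto simp: fM fV)
  have r2: "z < y + 1 \<longleftrightarrow> f z \<prec>\<^sub>T f y @ [E1]" if yz: "y \<in> insert M V" "z \<in> insert M V" for y z
  proof -
    have self: "a \<prec>\<^sub>T a @ [E1]" by (rule vprec_append) simp
    consider "y = M" "z = M" | "y = M" "z \<in> V" | "y \<in> V" "z = M" | "y \<in> V" "z \<in> V"
      using yz by blast
    then show ?thesis
    proof cases
      case 2
      have "z < M + 1" using M[OF 2(2)] by simp
      then show ?thesis using vprec_trans[OF a[OF 2(2)] self] 2 by (simp add: fM fV)
    qed (auto simp: fM fV self a1 plus1)
  qed
  have r3: "f z = f y @ [E1]" if "y \<in> insert M V" "z \<in> insert M V" "z = y + 1" for y z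
  proof -
    have "y \<noteq> M" using that M[of z] by auto
    then have y: "y \<in> V" using that by auto
    show ?thesis
    proof (cases "z = M")
      case True
      then show ?thesis using ae[OF y] that(3) fM fV[OF y] by metis
    next
      case False
      then have "z \<in> V" using that(2) by auto
      then show ?thesis using eq[OF y _ that(3)] fV[OF y] fV[of z] by metis
    qed
  qed
  have r4: "w \<in> f ` insert M V" if "y \<in> insert M V" "f y = w @ [e]" for y w e
  proof -
    have "w \<in> addr ` V" using that ap pre by (auto simp: fM fV)
    then show ?thesis using fV by (force simp: image_iff)
  qed
  have "addressing (insert M V) f"
    unfolding addressing_def
    by (intro conjI ballI allI impI) (rule r1 r2 r3 r4; assumption)+
  then show ?case by blast
qed

fun build :: "vertex set \<Rightarrow> (vertex \<Rightarrow> 'a set) \<Rightarrow> vertex set \<Rightarrow> nat \<Rightarrow> vertex \<Rightarrow> 'a btree" where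
  "build N L D 0 w = Leaf"
| "build N L D (Suc n) w = (if w \<in> N
     then Node (build N L D n (w @ [E0])) (L w) (if w @ [E1] \<in> D then Dashed else Solid)
       (build N L D n (w @ [E1]))
     else Leaf)"

lemma build_spec:
  assumes pre: "\<And>w e. w @ [e] \<in> N \<Longrightarrow> w \<in> N" and len: "\<And>v. v \<in> N \<Longrightarrow> length v < length w + n"
  shows "(v \<in> nodes (build N L D n w) \<longleftrightarrow> w @ v \<in> N) \<and>
    (w @ v \<in> N \<longrightarrow> node_label (build N L D n w) v = L (w @ v)) \<and>
    (dashed (build N L D n w) v \<longleftrightarrow> w @ v \<in> N \<and> w @ v @ [E1] \<in> D)"
  using len
proof (induction n arbitrary: w v)
  case 0
  then have "w @ v \<notin> N" by fastforce
  then show ?case by simp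
next
  case (Suc n)
  have prefix: "u @ t \<in> N \<Longrightarrow> u \<in> N" for u t
    by (induction t rule: rev_induct) (auto dest: pre simp flip: append_assoc)
  show ?case
  proof (cases "w \<in> N")
    case False
    then show ?thesis using prefix by auto
  next
    case True
    show ?thesis
    proof (cases v)
      case Nil
      then show ?thesis using True by simp
    next
      case (Cons b v')
      have IH: "(v' \<in> nodes (build N L D n (w @ [b])) \<longleftrightarrow> (w @ [b]) @ v' \<in> N) \<and>
        ((w @ [b]) @ v' \<in> N \<longrightarrow> node_label (build N L D n (w @ [b])) v' = L ((w @ [b]) @ v')) \<and>
        (dashed (build N L D n (w @ [b])) v' \<longleftrightarrow> (w @ [b]) @ v' \<in> N \<and> (w @ [b]) @ v' @ [E1] \<in> D)"
        by (rule Suc.IH) (use Suc.prems in force)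
      then show ?thesis using True Cons by (cases b) auto
    qed
  qed
qed

lemma tree_exists:
  assumes "finite N" and pre: "\<And>w e. w @ [e] \<in> N \<Longrightarrow> w \<in> N"
  shows "\<exists>T. nodes T = N \<and> (\<forall>v\<in>N. node_label T v = L v) \<and>
    (\<forall>v. dashed T v \<longleftrightarrow> v \<in> N \<and> v @ [E1] \<in> D)"
proof -
  obtain n where n: "\<And>v. v \<in> N \<Longrightarrow> length v < n"
    using finite_nat_set_iff_bounded[of "length ` N"] assms(1) by auto
  show ?thesis
    by (rule exI[of _ "build N L D n []"]) (use build_spec[of N "[]" n _ L D] pre n in auto)
qed

lemma tree_of_point_exists:
  fixes p :: "real^'n::finite"
  obtains T where "T \<in> decorated_trees UNIV" "tree_point T p"
proof -
  define V where "V = range (($) p)"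
  have inV: "p $ i \<in> V" for i by (simp add: V_def)
  have "finite V" by (simp add: V_def)
  then obtain addr where addr: "addressing V addr" using addressing_exists by blast
  note mono = addressingD(1)[OF addr] and plus1 = addressingD(2)[OF addr]
    and eq = addressingD(3)[OF addr] and pre = addressingD(4)[OF addr]
  have inj: "y = z" if "y \<in> V" "z \<in> V" "addr y = addr z" for y z
    using mono[of y z] mono[of z y] that by (metis linorder_neqE vprec_irrefl)
  define L where "L w = {i. addr (p $ i) = w}" for w
  define D where "D = {addr z | z. z \<in> V \<and> z - 1 \<in> V}"
  have fin: "finite (addr ` V)" using \<open>finite V\<close> by simp
  have closed: "w \<in> addr ` V" if we: "w @ [e] \<in> addr ` V" for w e
  proof -
    obtain y where "y \<in> V" "addr y = w @ [e]" using we by force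
    then show ?thesis by (rule pre)
  qed
  obtain T where *: "nodes T = addr ` V \<and> (\<forall>v\<in>addr ` V. node_label T v = L v) \<and>
      (\<forall>v. dashed T v \<longleftrightarrow> v \<in> addr ` V \<and> v @ [E1] \<in> D)"
    using tree_exists[OF fin closed] ..
  note N = conjunct1[OF *] and L = bspec[OF conjunct1[OF conjunct2[OF *]]]
    and D = spec[OF conjunct2[OF conjunct2[OF *]]]
  have "inj_on (node_label T) (nodes T)"
    by (rule inj_onI) (auto simp: N L L_def V_def)
  moreover have "partition_on UNIV (node_label T ` nodes T)"
    by (auto simp: partition_on_def disjoint_def N L L_def V_def)
  moreover have "e = Solid" if s: "subtree_at T v = Some (Node l A e Leaf)" for v l A e
  proof (rule ccontr)
    assume "e \<noteq> Solid"
    then have "dashed T v" using s by (cases e) (auto simp: dashed_def)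
    then have "v @ [E1] \<in> nodes T" using D N by (auto simp: D_def)
    then show False using subtree_at_snoc_E1[OF s] by (auto simp: nodes_def)
  qed
  ultimately have T: "T \<in> decorated_trees UNIV"
    by (auto simp: decorated_trees_def)
  have nd: "node_of T i = addr (p $ i)" for i
    by (rule node_of_eqI[OF T]) (auto simp: N L L_def inV)
  have "p $ i \<le> p $ j \<longleftrightarrow> node_of T i \<preceq>\<^sub>T node_of T j" for i j
  proof (cases "p $ j < p $ i")
    case True
    then show ?thesis using mono[OF inV inV True] by (simp add: nd flip: not_vpreceq)
  next
    case False
    then show ?thesis
      using mono[OF inV[of i] inV[of j]] by (cases "p $ i = p $ j") (auto simp: nd vpreceq_def)
  qed
  moreover have "p $ i < p $ j + 1 \<longleftrightarrow> node_of T i \<prec>\<^sub>T right_child_of T j" for i j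
    unfolding right_child_of_def nd using plus1[OF inV inV] .
  moreover have "p $ i = p $ j + 1 \<longleftrightarrow>
        node_of T i = right_child_of T j \<and> right_child_of T j \<in> captive_nodes T" for i j
  proof -
    have "p $ i = p $ j + 1 \<longleftrightarrow> addr (p $ i) = addr (p $ j) @ [E1] \<and> addr (p $ j) @ [E1] \<in> D"
    proof
      assume *: "p $ i = p $ j + 1"
      then have "p $ i - 1 \<in> V" using inV by simp
      then have "addr (p $ i) \<in> D" unfolding D_def using inV by blast
      then show "addr (p $ i) = addr (p $ j) @ [E1] \<and> addr (p $ j) @ [E1] \<in> D"
        using eq[OF inV inV *] by simp
    next
      assume *: "addr (p $ i) = addr (p $ j) @ [E1] \<and> addr (p $ j) @ [E1] \<in> D"
      then obtain z where z: "z \<in> V" "z - 1 \<in> V" "addr (p $ j) @ [E1] = addr z"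
        by (auto simp: D_def)
      have "addr z = addr (z - 1) @ [E1]" using eq[of "z - 1" z] z by simp
      then have "p $ j = z - 1" using inj[OF inV z(2)] z(3) by simp
      moreover have "p $ i = z" using inj[OF inV z(1)] z(3) * by simp
      ultimately show "p $ i = p $ j + 1" by simp
    qed
    then show ?thesis
      unfolding right_child_of_def nd dashed_iff_captive[OF T, symmetric] D using inV by auto
  qed
  ultimately have "tree_point T p" by (simp add: tree_point_def)
  with T show thesis by (rule that)
qed

subsection \<open>Faces of the Catalan arrangement\<close>

lemma sides_coordinate_difference:
  fixes i j :: "'n::finite" and p q :: "real^'n"
  assumes ij: "i \<noteq> j" and S: "S \<in> sides {x. x $ i - x $ j = c}" and p: "p \<in> S"
  shows "q \<in> S \<longleftrightarrow> sgn (q $ i - q $ j - c) = sgn (p $ i - p $ j - c)"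
proof -
  obtain a d where a: "a \<noteq> 0" and H: "{x. x $ i - x $ j = c} = {x. a \<bullet> x = d}"
    and S: "S = {x. a \<bullet> x < d} \<or> S = {x. a \<bullet> x = d} \<or> S = {x. a \<bullet> x > d}"
    using S by (auto simp: sides_def)
  have H': "x $ i - x $ j = c \<longleftrightarrow> a \<bullet> x = d" for x using H by blast
  define x0 where "x0 = axis i c"
  have x0: "x0 $ i - x0 $ j = c" using ij by (simp add: x0_def axis_def)
  have orth: "a \<bullet> v = 0" if "v $ i = v $ j" for v
    using H'[of "x0 + v"] H'[of x0] x0 that by (simp add: inner_add_right)
  have zero: "a $ k = 0" if "k \<noteq> i" "k \<noteq> j" for k
  proof -
    have "axis k (1::real) $ i = axis k 1 $ j" using that by (simp add: axis_def)
    from orth[OF this] show ?thesis by (simp add: inner_axis)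
  qed
  have opp: "a $ j = - a $ i"
  proof -
    have "(axis i (1::real) + axis j 1) $ i = (axis i 1 + axis j 1) $ j" using ij by (simp add: axis_def)
    from orth[OF this] show ?thesis by (simp add: inner_add_right inner_axis)
  qed
  have ax: "a \<bullet> x = a $ i * (x $ i - x $ j)" for x
  proof -
    have "a \<bullet> x = (\<Sum>k\<in>UNIV. a $ k * x $ k)" by (simp add: inner_vec_def)
    also have "\<dots> = (\<Sum>k\<in>{i, j}. a $ k * x $ k)"
      by (rule sum.mono_neutral_right) (auto simp: zero)
    also have "\<dots> = a $ i * (x $ i - x $ j)" using ij by (simp add: opp algebra_simps)
    finally show ?thesis .
  qed
  have ai: "a $ i \<noteq> 0"
  proof
    assume "a $ i = 0"
    then have "a $ k = 0" for k using zero opp by (cases "k = i"; cases "k = j") auto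
    then show False using a by (simp add: vec_eq_iff)
  qed
  have "d = a $ i * c" using H'[of x0] x0 ax by simp
  then have "a \<bullet> x - d = a $ i * (x $ i - x $ j - c)" for x by (simp add: ax algebra_simps)
  then have sg: "sgn (a \<bullet> x - d) = sgn (a $ i) * sgn (x $ i - x $ j - c)" for x
    by (simp add: sgn_mult)
  have "q \<in> S \<longleftrightarrow> sgn (a \<bullet> q - d) = sgn (a \<bullet> p - d)"
    using S p by (auto simp: sgn_if split: if_splits)
  then show ?thesis using ai by (simp add: sg sgn_eq_0_iff)
qed

lemma sides_cover:
  assumes "a \<noteq> 0" "H = {x. a \<bullet> x = c}"
  shows "\<exists>S\<in>sides H. p \<in> S"
proof -
  have S: "S \<in> sides H" if "S = {x. a \<bullet> x < c} \<or> S = {x. a \<bullet> x = c} \<or> S = {x. a \<bullet> x > c}" for S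
    unfolding sides_def by (intro CollectI exI[of _ a] exI[of _ c] conjI assms that)
  show ?thesis
  proof (cases "a \<bullet> p" c rule: linorder_cases)
    case less
    then show ?thesis by (intro bexI[OF _ S[of "{x. a \<bullet> x < c}"]]) auto
  next
    case equal
    then show ?thesis by (intro bexI[OF _ S[of "{x. a \<bullet> x = c}"]]) auto
  next
    case greater
    then show ?thesis by (intro bexI[OF _ S[of "{x. a \<bullet> x > c}"]]) auto
  qed
qed

definition same_face :: "real^'n \<Rightarrow> real^'n \<Rightarrow> bool" where
  "same_face p q \<longleftrightarrow> (\<forall>i j. i \<noteq> j \<longrightarrow> (\<forall>c\<in>{0, 1}.
     sgn (q $ i - q $ j - c) = sgn (p $ i - p $ j - c)))"

lemma catalan_arrangementE:
  assumes "H \<in> catalan_arrangement"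
  obtains i j c where "i \<noteq> j" "c \<in> {0, 1}" "H = {x. x $ i - x $ j = c}"
  using assms unfolding catalan_arrangement_def by blast

lemma catalan_arrangementI:
  "i \<noteq> j \<Longrightarrow> c \<in> {0, 1} \<Longrightarrow> {x. x $ i - x $ j = c} \<in> catalan_arrangement"
  unfolding catalan_arrangement_def by (cases "c = 0") blast+

lemma face_eq_same_face:
  fixes F :: "(real^'n::finite) set"
  assumes F: "F \<in> faces catalan_arrangement" and p: "p \<in> F"
  shows "F = {q. same_face p q}"
proof -
  obtain \<sigma> where \<sigma>: "\<And>H. H \<in> catalan_arrangement \<Longrightarrow> \<sigma> H \<in> sides H"
    and F_eq: "F = (\<Inter>H\<in>catalan_arrangement. \<sigma> H)"
    using F by (auto simp: faces_def)
  have iff: "q \<in> \<sigma> {x. x $ i - x $ j = c} \<longleftrightarrow>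
      sgn (q $ i - q $ j - c) = sgn (p $ i - p $ j - c)" if "i \<noteq> j" "c \<in> {0, 1}" for i j c q
  proof (rule sides_coordinate_difference)
    have "{x. x $ i - x $ j = c} \<in> (catalan_arrangement :: (real^'n) set set)"
      using that by (rule catalan_arrangementI)
    then show "\<sigma> {x. x $ i - x $ j = c} \<in> sides {x. x $ i - x $ j = c}"
      "p \<in> \<sigma> {x. x $ i - x $ j = c}"
      using \<sigma> p F_eq by auto
  qed (use that in auto)
  have "q \<in> F \<longleftrightarrow> (\<forall>i j c. i \<noteq> j \<longrightarrow> c \<in> {0, 1} \<longrightarrow> q \<in> \<sigma> {x. x $ i - x $ j = c})" for q
    unfolding F_eq by (auto elim!: catalan_arrangementE intro: catalan_arrangementI simp del: right_minus_eq)
  then show ?thesis using iff unfolding same_face_def by auto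
qed

lemma same_face_in_faces:
  fixes p :: "real^'n::finite"
  shows "{q. same_face p q} \<in> faces catalan_arrangement"
proof -
  have "\<exists>S\<in>sides H. p \<in> S" if HA: "H \<in> catalan_arrangement" for H :: "(real^'n) set"
  proof -
    obtain i j c where ij: "i \<noteq> j" and "c \<in> {0, 1}" and H: "H = {x. x $ i - x $ j = c}"
      using HA by (rule catalan_arrangementE)
    define a :: "real^'n" where "a = axis i 1 - axis j 1"
    have "a $ i \<noteq> 0" using ij by (simp add: a_def axis_def)
    then have "a \<noteq> 0" by auto
    moreover have "H = {x. a \<bullet> x = c}" unfolding H a_def by (simp add: inner_diff_left inner_axis')
    ultimately show ?thesis by (rule sides_cover)
  qed
  then obtain \<sigma> where \<sigma>: "\<And>H. H \<in> catalan_arrangement \<Longrightarrow> \<sigma> H \<in> sides H \<and> p \<in> \<sigma> H"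
    by metis
  define F where "F = (\<Inter>H\<in>catalan_arrangement. \<sigma> H)"
  have p: "p \<in> F" using \<sigma> by (auto simp: F_def)
  have "F \<in> faces catalan_arrangement" using \<sigma> p by (auto simp: faces_def F_def)
  then show ?thesis using face_eq_same_face[OF _ p] by simp
qed

lemma same_face_iff:
  "same_face p q \<longleftrightarrow> (\<forall>i j. (p $ i \<le> p $ j \<longleftrightarrow> q $ i \<le> q $ j) \<and>
     (p $ i < p $ j + 1 \<longleftrightarrow> q $ i < q $ j + 1) \<and> (p $ i = p $ j + 1 \<longleftrightarrow> q $ i = q $ j + 1))"
  (is "_ \<longleftrightarrow> (\<forall>i j. ?P i j)")
proof
  assume s: "same_face p q"
  show "\<forall>i j. ?P i j"
  proof (intro allI)
    fix i j
    show "?P i j"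
    proof (cases "i = j")
      case False
      then have "sgn (q $ i - q $ j - 0) = sgn (p $ i - p $ j - 0)"
        "sgn (q $ i - q $ j - 1) = sgn (p $ i - p $ j - 1)"
        using s unfolding same_face_def by blast+
      then show ?thesis by (auto simp: sgn_if split: if_splits)
    qed simp
  qed
next
  assume P: "\<forall>i j. ?P i j"
  show "same_face p q"
    unfolding same_face_def
  proof (intro allI impI ballI)
    fix i j and c :: real assume c: "c \<in> {0, 1}"
    have P: "?P i j" "?P j i" using P by blast+
    have iff: "p $ i < p $ j + c \<longleftrightarrow> q $ i < q $ j + c" "p $ i = p $ j + c \<longleftrightarrow> q $ i = q $ j + c"
      using c P by (smt (verit) insertE emptyE)+
    show "sgn (q $ i - q $ j - c) = sgn (p $ i - p $ j - c)"
    proof (cases "p $ i" "p $ j + c" rule: linorder_cases)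
      case less
      then have "q $ i < q $ j + c" using iff by blast
      with less show ?thesis by (simp add: sgn_if)
    next
      case equal
      then have "q $ i = q $ j + c" using iff by blast
      with equal show ?thesis by simp
    next
      case greater
      then have "q $ j + c < q $ i" using iff by linarith
      with greater show ?thesis by (simp add: sgn_if)
    qed
  qed
qed

lemma tree_point_same_face:
  assumes "tree_point T p"
  shows "tree_point T q \<longleftrightarrow> same_face p q"
proof -
  have 1: "node_of T i \<preceq>\<^sub>T node_of T j \<longleftrightarrow> p $ i \<le> p $ j" for i j
    using assms by (simp add: tree_point_def)
  have 2: "node_of T i \<prec>\<^sub>T right_child_of T j \<longleftrightarrow> p $ i < p $ j + 1" for i j
    using assms by (simp add: tree_point_def)
  have 3: "node_of T i = right_child_of T j \<and> right_child_of T j \<in> captive_nodes T \<longleftrightarrow>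
      p $ i = p $ j + 1" for i j
    using assms by (simp add: tree_point_def)
  show ?thesis
    unfolding tree_point_def same_face_iff 1 2 3 all_conj_distrib
    by (intro conj_cong all_cong1 eq_commute)
qed

lemma is_face_of_tree_iff:
  fixes T :: "'n::finite btree"
  assumes T: "T \<in> decorated_trees UNIV"
  shows "is_face_of_tree T F \<longleftrightarrow> F = {p. tree_point T p}"
proof -
  obtain p where p: "tree_point T p" using tree_point_exists[OF T] by blast
  have "{p. tree_point T p} = {q. same_face p q}" using tree_point_same_face[OF p] by simp
  then have "{p. tree_point T p} \<in> faces catalan_arrangement" using same_face_in_faces by simp
  then show ?thesis unfolding is_face_of_tree_def by auto
qed

lemma \<Phi>_eq:
  fixes T :: "'n::finite btree"
  assumes "T \<in> decorated_trees UNIV"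
  shows "\<Phi> T = {p. tree_point T p}"
  unfolding \<Phi>_def is_face_of_tree_iff[OF assms] by simp

lemma bij_betw_\<Phi>:
  "bij_betw \<Phi> (decorated_trees (UNIV :: 'n::finite set))
     (faces (catalan_arrangement :: (real^'n) set set))"
  unfolding bij_betw_def
proof (intro conjI subset_antisym subsetI)
  show "inj_on \<Phi> (decorated_trees (UNIV :: 'n set))"
  proof (rule inj_onI)
    fix T T' :: "'n btree"
    assume T: "T \<in> decorated_trees UNIV" "T' \<in> decorated_trees UNIV" and eq: "\<Phi> T = \<Phi> T'"
    obtain p where p: "tree_point T p" using tree_point_exists[OF T(1)] by blast
    then have "tree_point T' p" using eq \<Phi>_eq[OF T(1)] \<Phi>_eq[OF T(2)] by blast
    then show "T = T'" using tree_point_unique[OF T p] by blast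
  qed
  show "F \<in> faces catalan_arrangement" if F: "F \<in> \<Phi> ` decorated_trees (UNIV :: 'n set)" for F
  proof -
    obtain T :: "'n btree" where T: "T \<in> decorated_trees UNIV" "F = \<Phi> T" using F by blast
    then have "is_face_of_tree T F" using is_face_of_tree_iff[OF T(1)] \<Phi>_eq[OF T(1)] by simp
    then show ?thesis by (simp add: is_face_of_tree_def)
  qed
  show "F \<in> \<Phi> ` decorated_trees (UNIV :: 'n set)"
    if F: "F \<in> faces (catalan_arrangement :: (real^'n) set set)" for F
  proof -
    obtain p where p: "p \<in> F" using F by (auto simp: faces_def)
    obtain T where T: "T \<in> decorated_trees UNIV" "tree_point T p" using tree_of_point_exists[of p] .
    have "F = {q. same_face p q}" by (rule face_eq_same_face[OF F p])
    also have "\<dots> = \<Phi> T" using \<Phi>_eq[OF T(1)] tree_point_same_face[OF T(2)] by simp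
    finally show ?thesis using T(1) by blast
  qed
qed

subsection \<open>Dimension\<close>

lemma
  fixes r :: "'n::finite \<Rightarrow> 'b"
  defines "L \<equiv> {x :: real^'n. \<forall>i j. r i = r j \<longrightarrow> x $ i = x $ j}"
  shows subspace_constant_on_fibres: "subspace L"
    and dim_constant_on_fibres: "dim L = card (range r)"
proof -
  have LI: "x \<in> L" if "\<And>i j. r i = r j \<Longrightarrow> x $ i = x $ j" for x
    using that unfolding L_def by blast
  have LD: "x $ i = x $ j" if "x \<in> L" "r i = r j" for x i j
    using that unfolding L_def by blast
  show sub: "subspace L"
  proof (rule subspaceI)
    show "0 \<in> L" by (rule LI) simp
    show "x + y \<in> L" if "x \<in> L" "y \<in> L" for x y
    proof (rule LI)
      fix i j assume "r i = r j"
      then show "(x + y) $ i = (x + y) $ j" using LD[OF that(1), of i j] LD[OF that(2), of i j] by simp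
    qed
    show "c *\<^sub>R x \<in> L" if "x \<in> L" for c x
    proof (rule LI)
      fix i j assume "r i = r j"
      then show "(c *\<^sub>R x) $ i = (c *\<^sub>R x) $ j" using LD[OF that, of i j] by simp
    qed
  qed
  define b :: "'b \<Rightarrow> real^'n" where "b c = (\<chi> i. if r i = c then 1 else 0)" for c
  have inj: "inj_on b (range r)"
  proof (rule inj_onI)
    fix c d assume c: "c \<in> range r" and "b c = b d"
    moreover obtain i where "c = r i" using c by blast
    ultimately have "b d $ i = 1" by (metis (mono_tags, lifting) b_def vec_lambda_beta)
    then show "c = d" using \<open>c = r i\<close> by (auto simp: b_def split: if_splits)
  qed
  have "pairwise orthogonal (b ` range r)"
    by (auto simp: pairwise_def orthogonal_def inner_vec_def b_def intro!: sum.neutral)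
  moreover have "0 \<notin> b ` range r"
  proof
    assume "0 \<in> b ` range r"
    then obtain i where "0 = b (r i)" by blast
    moreover have "b (r i) $ i = 1" by (simp add: b_def)
    ultimately show False by (metis zero_index zero_neq_one)
  qed
  ultimately have ind: "independent (b ` range r)" by (rule pairwise_orthogonal_independent)
  have "L \<subseteq> span (b ` range r)"
  proof
    fix x assume x: "x \<in> L"
    define s where "s c = inv r c" for c
    have "x $ i = (\<Sum>c\<in>range r. x $ s c *\<^sub>R b c) $ i" for i
    proof -
      have "(\<Sum>c\<in>range r. x $ s c *\<^sub>R b c) $ i = x $ s (r i)"
        by (simp add: b_def if_distrib[where f = "(*) _"] cong: if_cong)
      also have "\<dots> = x $ i"
        by (rule LD[OF x]) (simp add: s_def f_inv_into_f)
      finally show ?thesis by simp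
    qed
    then have "x = (\<Sum>c\<in>range r. x $ s c *\<^sub>R b c)" unfolding vec_eq_iff by blast
    also have "\<dots> \<in> span (b ` range r)"
      by (intro span_sum span_scale span_base) auto
    finally show "x \<in> span (b ` range r)" .
  qed
  moreover have "b ` range r \<subseteq> L" by (auto simp: b_def intro!: LI)
  ultimately have "dim L = card (b ` range r)" using ind basis_card_eq_dim by metis
  then show "dim L = card (range r)" using card_image[OF inj] by simp
qed

function free_ancestor :: "'a btree \<Rightarrow> vertex \<Rightarrow> vertex" where
  "free_ancestor T v = (if v \<in> captive_nodes T then free_ancestor T (butlast v) else v)"
  by auto
termination
  by (relation "Wellfounded.measure (\<lambda>(T, v). length v)") (auto simp: captive_nodes_iff)

declare free_ancestor.simps [simp del]

lemma free_ancestor_simps [simp]: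
  "v @ [e] \<in> captive_nodes T \<Longrightarrow> free_ancestor T (v @ [e]) = free_ancestor T v"
  "v \<notin> captive_nodes T \<Longrightarrow> free_ancestor T v = v"
  by (simp_all add: free_ancestor.simps)

lemma free_ancestor_in_free_nodes: "v \<in> nodes T \<Longrightarrow> free_ancestor T v \<in> free_nodes T"
proof (induction T v rule: free_ancestor.induct)
  case (1 T v)
  show ?case
  proof (cases "v \<in> captive_nodes T")
    case True
    then have "butlast v \<in> nodes T" by (auto simp: captive_nodes_iff dest: nodes_prefix_closed)
    then show ?thesis using 1 True by (simp add: free_ancestor.simps[of T v])
  next
    case False
    then show ?thesis using 1 by (simp add: free_nodes_def)
  qed
qed

lemma constant_on_free_ancestor_fibres:
  fixes x :: "real^'n::finite"
  assumes T: "T \<in> decorated_trees UNIV"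
    and same: "\<And>i j. node_of T i = node_of T j \<Longrightarrow> x $ i = x $ j"
    and captive: "\<And>i j. node_of T i = node_of T j @ [E1] \<Longrightarrow> node_of T i \<in> captive_nodes T \<Longrightarrow> x $ i = x $ j"
    and eq: "free_ancestor T (node_of T i) = free_ancestor T (node_of T j)"
  shows "x $ i = x $ j"
proof -
  have *: "x $ i = x $ k" if "node_of T k = free_ancestor T (node_of T i)" for i k
    using that
  proof (induction "length (node_of T i)" arbitrary: i rule: less_induct)
    case less
    show ?case
    proof (cases "node_of T i \<in> captive_nodes T")
      case True
      then obtain u where u: "node_of T i = u @ [E1]" "u @ [E1] \<in> nodes T"
        unfolding captive_nodes_iff by auto
      then obtain m where m: "u = node_of T m"
        using nodes_prefix_closed[OF u(2)] nodes_eq_range_node_of[OF T] by auto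
      have "x $ i = x $ m" using captive[of i m] u m True by simp
      moreover have "node_of T k = free_ancestor T (node_of T m)"
        using less.prems True u m by simp
      then have "x $ m = x $ k" using less.hyps[of m] u m by simp
      ultimately show ?thesis by simp
    next
      case False
      then show ?thesis using less.prems same[of i k] by simp
    qed
  qed
  have "free_ancestor T (node_of T i) \<in> nodes T"
    using free_ancestor_in_free_nodes node_of_in_nodes[OF T] by (force simp: free_nodes_def)
  then obtain k where k: "node_of T k = free_ancestor T (node_of T i)"
    using nodes_eq_range_node_of[OF T] by auto
  show ?thesis using *[OF k] *[OF k[unfolded eq]] by simp
qed

lemma range_free_ancestor:
  assumes T: "T \<in> decorated_trees UNIV"
  shows "range (\<lambda>i. free_ancestor T (node_of T i)) = free_nodes T"
proof (intro subset_antisym subsetI)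
  fix v assume v: "v \<in> free_nodes T"
  then obtain i where i: "v = node_of T i"
    using nodes_eq_range_node_of[OF T] by (auto simp: free_nodes_def)
  have "free_ancestor T v = v" using v by (simp add: free_nodes_def)
  then show "v \<in> range (\<lambda>i. free_ancestor T (node_of T i))" using i by (metis rangeI)
qed (use free_ancestor_in_free_nodes node_of_in_nodes[OF T] in auto)

lemma aff_dim_tree_points:
  fixes T :: "'n::finite btree"
  assumes T: "T \<in> decorated_trees UNIV"
  shows "aff_dim {p. tree_point T p} = int (card (free_nodes T))"
proof -
  obtain p0 where p0: "tree_point T p0" using tree_point_exists[OF T] by blast
  define r where "r i = free_ancestor T (node_of T i)" for i
  define L where "L = {x :: real^'n. \<forall>i j. r i = r j \<longrightarrow> x $ i = x $ j}"
  have sub: "subspace L" unfolding L_def by (rule subspace_constant_on_fibres)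
  define A where "A = (+) p0 ` L"
  have mem_A: "p \<in> A \<longleftrightarrow> p - p0 \<in> L" for p
    unfolding A_def by (metis add_diff_cancel_left' diff_add_cancel add.commute image_iff)
  define U where "U = {p :: real^'n. \<forall>i j.
    (node_of T i \<prec>\<^sub>T node_of T j \<longrightarrow> p $ i < p $ j) \<and>
    (node_of T i \<prec>\<^sub>T node_of T j @ [E1] \<longrightarrow> p $ i < p $ j + 1) \<and>
    (p0 $ j + 1 < p0 $ i \<longrightarrow> p $ j + 1 < p $ i)}"
  have "open U"
  proof -
    have "U = (\<Inter>i. \<Inter>j. {p.
      (node_of T i \<prec>\<^sub>T node_of T j \<longrightarrow> p $ i < p $ j) \<and>
      (node_of T i \<prec>\<^sub>T node_of T j @ [E1] \<longrightarrow> p $ i < p $ j + 1) \<and>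
      (p0 $ j + 1 < p0 $ i \<longrightarrow> p $ j + 1 < p $ i)})"
      unfolding U_def by blast
    also have "open \<dots>"
      by (intro open_INT finite ballI open_Collect_conj open_Collect_imp closed_Collect_const
          open_Collect_less continuous_intros)
    finally show ?thesis .
  qed
  have "{p. tree_point T p} = A \<inter> U"
  proof (intro set_eqI iffI)
    fix p assume "p \<in> {p. tree_point T p}"
    then have p: "tree_point T p" by simp
    have s: "same_face p0 p" using p tree_point_same_face[OF p0] by blast
    have "(p - p0) $ i = (p - p0) $ j" if "r i = r j" for i j
    proof (rule constant_on_free_ancestor_fibres[OF T])
      show "(p - p0) $ i = (p - p0) $ j" if "node_of T i = node_of T j" for i j
        using that tree_point_eq[OF p, of i j] tree_point_eq[OF p0, of i j] by simp
      show "(p - p0) $ i = (p - p0) $ j"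
        if "node_of T i = node_of T j @ [E1]" "node_of T i \<in> captive_nodes T" for i j
        using that tree_point_eq_plus_1[OF p, of i j] tree_point_eq_plus_1[OF p0, of i j] by simp
    qed (use that in \<open>simp add: r_def\<close>)
    then have "p \<in> A" unfolding mem_A L_def by blast
    moreover have "p \<in> U"
    proof -
      have "p $ j + 1 < p $ i" if "p0 $ j + 1 < p0 $ i" for i j
      proof -
        have "p0 $ i < p0 $ j + 1 \<longleftrightarrow> p $ i < p $ j + 1" "p0 $ i = p0 $ j + 1 \<longleftrightarrow> p $ i = p $ j + 1"
          using s unfolding same_face_iff by blast+
        then show ?thesis using that by linarith
      qed
      moreover have "p $ i < p $ j + 1" if "node_of T i \<prec>\<^sub>T node_of T j @ [E1]" for i j
        using that p by (simp add: tree_point_def right_child_of_def)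
      ultimately show ?thesis unfolding U_def using tree_point_less[OF p] by blast
    qed
    ultimately show "p \<in> A \<inter> U" by blast
  next
    fix p assume p: "p \<in> A \<inter> U"
    have lt: "p $ i < p $ j" if "p0 $ i < p0 $ j" for i j
      using p that tree_point_less[OF p0] unfolding U_def by blast
    have lt1: "p $ i < p $ j + 1" if "p0 $ i < p0 $ j + 1" for i j
      using p that p0 unfolding U_def tree_point_def right_child_of_def by blast
    have gt1: "p $ j + 1 < p $ i" if "p0 $ j + 1 < p0 $ i" for i j
      using p that unfolding U_def by blast
    have diff: "p $ i - p0 $ i = p $ j - p0 $ j" if "r i = r j" for i j
    proof -
      have "p - p0 \<in> L" using p mem_A by blast
      then have "(p - p0) $ i = (p - p0) $ j" using that unfolding L_def by blast
      then show ?thesis by simp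
    qed
    have eq: "p $ i = p $ j" if "p0 $ i = p0 $ j" for i j
    proof -
      have "r i = r j" using that tree_point_eq[OF p0] by (simp add: r_def)
      then show ?thesis using diff[of i j] that by simp
    qed
    have eq1: "p $ i = p $ j + 1" if "p0 $ i = p0 $ j + 1" for i j
    proof -
      have "r i = r j"
        using that tree_point_eq_plus_1[OF p0, of i j]
        by (simp add: r_def)
      then show ?thesis using diff[of i j] that by simp
    qed
    have "same_face p0 p"
      unfolding same_face_iff
    proof (intro allI conjI)
      fix i j
      show "p0 $ i \<le> p0 $ j \<longleftrightarrow> p $ i \<le> p $ j"
        using lt[of i j] lt[of j i] eq[of i j] by linarith
      show "p0 $ i < p0 $ j + 1 \<longleftrightarrow> p $ i < p $ j + 1" "p0 $ i = p0 $ j + 1 \<longleftrightarrow> p $ i = p $ j + 1"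
        using lt1[of i j] gt1[of j i] eq1[of i j] by linarith+
    qed
    then show "p \<in> {p. tree_point T p}" using tree_point_same_face[OF p0] by simp
  qed
  moreover have "affine A"
    unfolding A_def using sub by (simp add: affine_translation[symmetric] subspace_imp_affine)
  moreover have "A \<inter> U \<noteq> {}" using p0 calculation(1) by blast
  ultimately have "affine hull {p. tree_point T p} = affine hull A"
    using affine_hull_affine_Int_open[OF _ \<open>open U\<close>] by simp
  then have "aff_dim {p. tree_point T p} = aff_dim A" by (metis aff_dim_affine_hull)
  also have "\<dots> = aff_dim L" unfolding A_def by (rule aff_dim_translation_eq)
  also have "\<dots> = int (dim L)" using aff_dim_subspace[OF sub] .
  also have "dim L = card (range r)" unfolding L_def by (rule dim_constant_on_fibres)
  also have "range r = free_nodes T" using range_free_ancestor[OF T] by (simp add: r_def)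
  finally show ?thesis .
qed

theorem theorem2p5:
  "(\<forall>T \<in> decorated_trees (UNIV :: 'n::finite set). \<exists>!F. is_face_of_tree T F) \<and>
   bij_betw \<Phi> (decorated_trees (UNIV :: 'n set)) (faces (catalan_arrangement :: (real^'n) set set)) \<and>
   (\<forall>T \<in> decorated_trees (UNIV :: 'n set). \<forall>k::nat.
      card (free_nodes T) = k \<longleftrightarrow> aff_dim (\<Phi> T) = int k)"
  using is_face_of_tree_iff bij_betw_\<Phi> by (auto simp: \<Phi>_eq aff_dim_tree_points)

end
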